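(* Let $m = q^k n^2$ be an odd perfect number with special prime $q$, and put $$l_1(q,n) = \frac{3q^2 - 4q + 2}{q(q - 1)} - \frac{q}{(q - 1)(2qn^2 - 2n^2 + 1)} + \frac{1}{qn^2}.$$ If $K$ is a real number with $g(K) = l_1(q,n)$, then $$\frac{q^{K+1} - 1}{q - 1} = 2n^2.$$ In particular, $$K < \log_q 2 + 2\log_q n.$$
   Context: For a positive integer $x$, $\sigma(x)=\sum_{d\mid x} d$ is the sum of its positive divisors and $I(x)=\sigma(x)/x$ is its abundancy index. An odd perfect number is an odd positive integer $m$ with $\sigma(m)=2m$. "$q^k n^2$ is an odd perfect number with special prime $q$" means that $m=q^k n^2$ is an odd perfect number, where $k,n$ are positive integers, $q$ is a prime, $q\equiv k\equiv 1 \pmod 4$, and $\gcd(q,n)=1$ (Euler's form). For fixed $q$, the function $g$ of a real variable $x\ge 1$ is $$g(x)=3-\frac{(q^x-1)(q^{x+1}-2q^x+1)}{q^x(q-1)(q^{x+1}-1)};$$ for the given odd perfect number one has $g(k)=I(q^k)+I(n^2)$. In particular the argument $K$ of $g$ is a real number with $K\ge 1$. *)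

theory Defs
  imports Complex_Main "HOL-Computational_Algebra.Primes" "HOL-Number_Theory.Cong"
begin

definition sigma :: "nat \<Rightarrow> nat" where
  "sigma x = (\<Sum>d | d dvd x. d)"

text \<open>Positivity follows from oddness.\<close>

definition odd_perfect :: "nat \<Rightarrow> bool" where
  "odd_perfect m \<longleftrightarrow> odd m \<and> sigma m = 2 * m"

definition odd_perfect_euler :: "nat \<Rightarrow> nat \<Rightarrow> nat \<Rightarrow> bool" where
  "odd_perfect_euler q k n \<longleftrightarrow>
     odd_perfect (q ^ k * n\<^sup>2) \<and> k > 0 \<and> n > 0 \<and> prime q \<and>
     [q = 1] (mod 4) \<and> [k = 1] (mod 4) \<and> coprime q n"

text \<open>Meant for real \<open>x \<ge> 1\<close>. With \<open>I(x) = sigma x / x\<close>, an odd perfect number \<open>q ^ k * n\<^sup>2\<close>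
  in Euler's form satisfies \<open>g q k = I(q ^ k) + I(n\<^sup>2)\<close>.\<close>

definition g :: "nat \<Rightarrow> real \<Rightarrow> real" where
  "g q x = 3 - ((real q powr x - 1) * (real q powr (x + 1) - 2 * real q powr x + 1)) /
               (real q powr x * (real q - 1) * (real q powr (x + 1) - 1))"

definition l1 :: "nat \<Rightarrow> nat \<Rightarrow> real" where
  "l1 q n = (3 * (real q)\<^sup>2 - 4 * real q + 2) / (real q * (real q - 1))
          - real q / ((real q - 1) * (2 * real q * (real n)\<^sup>2 - 2 * (real n)\<^sup>2 + 1))
          + 1 / (real q * (real n)\<^sup>2)"

end

theory Submission
  imports Defs
begin

text \<open>Write \<open>Y = q powr K\<close> and let \<open>A Y = (q * Y - 1) / ((q - 1) * Y)\<close>, the real-argument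
  version of the abundancy index of the prime power \<open>Y\<close>. Both sides of the equation
  \<open>g q K = l1 q n\<close> are values of the map \<open>t \<mapsto> t + 2 / t\<close>: the left side at \<open>t = A Y\<close>, by an
  identity whose origin is the case \<open>K = k\<close>, where the abundancy indices of \<open>q ^ k\<close> and \<open>n\<^sup>2\<close>
  multiply to \<open>2\<close>; the right side at \<open>t = A Y0\<close>, where \<open>Y0\<close> solves \<open>(q * Y0 - 1) / (q - 1) = 2 * n\<^sup>2\<close>. Two distinct points with
  the same value under this map have product \<open>2\<close>. As \<open>q \<ge> 5\<close>, both points lie strictly between
  \<open>0\<close> and \<open>q / (q - 1) \<le> 5 / 4\<close>, so their product is too small; hence they agree, and \<open>Y = Y0\<close>
  because \<open>A\<close> is injective. The logarithmic bound is \<open>Y0 < 2 * n\<^sup>2\<close>, which says that \<open>A Y0 > 1\<close>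
  and holds because \<open>Y0 > 1\<close>.\<close>

lemma prime_cong_1_mod_4_ge_5:
  fixes q :: nat
  assumes "prime q" and "[q = 1] (mod 4)"
  shows "q \<ge> 5"
proof -
  have "q mod 4 = 1" using assms(2) by (simp add: cong_def)
  moreover have "q > 1" using assms(1) by (rule prime_gt_1_nat)
  ultimately show ?thesis by presburger
qed

text \<open>The difference of the two values factors as \<open>(s - t) * (s * t - 2) / (s * t)\<close>.\<close>

lemma add_two_divide_cancel:
  fixes s t :: real
  assumes "0 < s" "0 < t" "s * t < 2" and "s + 2 / s = t + 2 / t"
  shows "s = t"
proof -
  have "(s - t) * (s * t - 2) = 0"
    using assms(1,2,4) by (simp add: field_simps)
  then show ?thesis using assms(3) by simp
qed

definition abundancy_real :: "real \<Rightarrow> real \<Rightarrow> real" where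
  "abundancy_real p y = (p * y - 1) / ((p - 1) * y)"

lemma abundancy_real_pos:
  assumes "p > 1" "y > 0" "p * y > 1"
  shows "abundancy_real p y > 0"
  using assms by (simp add: abundancy_real_def)

lemma abundancy_real_less_5_4:
  assumes "p \<ge> 5" "y > 0"
  shows "abundancy_real p y < 5 / 4"
proof -
  have "5 * y \<le> p * y" using assms by (intro mult_right_mono) auto
  then have "4 * (p * y - 1) < 5 * ((p - 1) * y)" by (simp add: algebra_simps)
  then show ?thesis using assms by (simp add: abundancy_real_def divide_less_eq)
qed

lemma abundancy_real_eq_iff:
  assumes "p > 1" "y > 0" "z > 0"
  shows "abundancy_real p y = abundancy_real p z \<longleftrightarrow> y = z"
proof -
  have "abundancy_real p w = p / (p - 1) - 1 / ((p - 1) * w)" if "w > 0" for w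
    using assms(1) that by (simp add: abundancy_real_def diff_divide_distrib)
  then show ?thesis using assms by simp
qed

lemma g_eq_abundancy_real:
  assumes "q > 1" and "K \<ge> 0"
  shows "g q K = abundancy_real q (real q powr K) + 2 / abundancy_real q (real q powr K)"
proof -
  define Y where "Y = real q powr K"
  have q: "real q - 1 \<noteq> 0" and Y1: "Y \<ge> 1"
    using assms by (auto simp: Y_def ge_one_powr_ge_zero)
  have "1 * 1 < real q * Y" using assms(1) Y1 by (intro mult_less_le_imp_less) auto
  then have D: "real q * Y - 1 \<noteq> 0" by simp
  have Y: "Y \<noteq> 0" using Y1 by simp
  have "real q powr (K + 1) = real q * Y"
    using assms(1) by (simp add: Y_def powr_add)
  then have "g q K = 3 - ((Y - 1) * (real q * Y - 2 * Y + 1)) / (Y * (real q - 1) * (real q * Y - 1))"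
    by (simp add: g_def Y_def)
  also have "\<dots> = (real q * Y - 1) / ((real q - 1) * Y) + 2 * ((real q - 1) * Y) / (real q * Y - 1)"
    using q D Y by (simp add: divide_simps) (simp add: algebra_simps power2_eq_square)
  finally show ?thesis by (simp add: abundancy_real_def Y_def)
qed

text \<open>The argument on the right is the solution \<open>Y\<close> of \<open>(q * Y - 1) / (q - 1) = 2 * n\<^sup>2\<close>.\<close>

lemma l1_eq_abundancy_real:
  fixes q n :: nat
  defines "Y \<equiv> (2 * (real n)\<^sup>2 * (real q - 1) + 1) / real q"
  assumes "q > 1" and "n > 0"
  shows "l1 q n = abundancy_real q Y + 2 / abundancy_real q Y"
proof -
  define N where "N = (real n)\<^sup>2"
  define D where "D = 2 * N * (real q - 1) + 1"
  have N: "N > 0" and q: "real q > 1" using assms(2,3) by (auto simp: N_def)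
  then have D: "D > 0" by (simp add: D_def add_pos_pos)
  have A: "abundancy_real q Y = 2 * N * real q / D"
  proof -
    have Y: "Y = D / real q" by (simp add: Y_def D_def N_def)
    have "real q * Y - 1 = 2 * N * (real q - 1)" using q by (simp add: Y D_def)
    then show ?thesis using q D by (simp add: abundancy_real_def Y)
  qed
  have "l1 q n = (3 * (real q)\<^sup>2 - 4 * real q + 2) / (real q * (real q - 1))
      - real q / ((real q - 1) * D) + 1 / (real q * N)"
    by (simp add: l1_def D_def N_def algebra_simps)
  also have "(3 * (real q)\<^sup>2 - 4 * real q + 2) / (real q * (real q - 1))
      = real q / (real q - 1) + 2 * (real q - 1) / real q"
    using q by (simp add: divide_simps) algebra
  also have "real q / (real q - 1) + 2 * (real q - 1) / real q - real q / ((real q - 1) * D)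
      + 1 / (real q * N) = 2 * N * real q / D + D / (N * real q)"
  proof -
    have "real q / (real q - 1) - real q / ((real q - 1) * D) = 2 * N * real q / D"
      using q D by (simp add: divide_simps) (simp add: D_def algebra_simps)
    moreover have "2 * (real q - 1) / real q + 1 / (real q * N) = D / (N * real q)"
      using q N by (simp add: divide_simps) (simp add: D_def algebra_simps)
    ultimately show ?thesis by simp
  qed
  finally show ?thesis by (simp add: A)
qed

theorem theorem5:
  fixes q k n :: nat and K :: real
  assumes "odd_perfect_euler q k n"
    and "K \<ge> 1"
    and "g q K = l1 q n"
  shows "(real q powr (K + 1) - 1) / (real q - 1) = 2 * (real n)\<^sup>2 \<and>
         K < log (real q) 2 + 2 * log (real q) (real n)"
proof -
  define Y where "Y = real q powr K"
  define Z where "Z = (2 * (real n)\<^sup>2 * (real q - 1) + 1) / real q"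
  let ?s = "abundancy_real q Y" and ?t = "abundancy_real q Z"
  have n: "n > 0" and q5: "q \<ge> 5"
    using assms(1) prime_cong_1_mod_4_ge_5 by (auto simp: odd_perfect_euler_def)
  have qZ: "real q * Z = 2 * (real n)\<^sup>2 * (real q - 1) + 1"
    using q5 by (simp add: Z_def)
  have N1: "(real n)\<^sup>2 \<ge> 1" using n by simp
  have qZ1: "real q * Z > 1" using q5 n by (simp add: qZ)
  then have "0 < real q * Z" by linarith
  then have Z: "Z > 0" using q5 by (simp add: zero_less_mult_iff)
  have Y1: "Y \<ge> 1" using q5 assms(2) by (simp add: Y_def ge_one_powr_ge_zero)
  have "1 * 1 < real q * Y" using q5 Y1 by (intro mult_less_le_imp_less) auto
  then have pos: "?s > 0" "?t > 0"
    using q5 Y1 Z qZ1 by (auto intro!: abundancy_real_pos)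
  have "?s * ?t < (5 / 4) * (5 / 4)"
    using q5 Y1 Z pos by (intro mult_strict_mono abundancy_real_less_5_4) auto
  then have "?s * ?t < 2" by simp
  moreover have "?s + 2 / ?s = ?t + 2 / ?t"
    using g_eq_abundancy_real[of q K] l1_eq_abundancy_real[of q n] assms(2,3) q5 n
    by (simp add: Y_def Z_def)
  ultimately have "?s = ?t" using add_two_divide_cancel pos by blast
  then have YZ: "Y = Z" using abundancy_real_eq_iff[of q Y Z] q5 Y1 Z by simp
  have "real q powr (K + 1) = real q * Z"
    using q5 by (simp add: powr_add YZ[symmetric] Y_def)
  then have sum: "(real q powr (K + 1) - 1) / (real q - 1) = 2 * (real n)\<^sup>2"
    using q5 by (simp add: qZ)
  have "real q * Z < real q * (2 * (real n)\<^sup>2)"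
    unfolding qZ using N1 by (simp add: algebra_simps)
  then have "real q powr K < 2 * (real n)\<^sup>2"
    using q5 YZ by (simp add: Y_def)
  then have "K < log (real q) (2 * (real n)\<^sup>2)"
    using q5 n by (simp add: less_log_iff)
  also have "\<dots> = log (real q) 2 + 2 * log (real q) (real n)"
    using q5 n by (simp add: log_mult log_nat_power)
  finally show ?thesis using sum by simp
qed

end
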